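(* Let $\mathcal{G}\subseteq 2^{\{1,\ldots,p\}}$ be a set of groups, let $(\eta_g)_{g\in\mathcal{G}}$ be positive weights, and let $\Omega$ be the norm on $\mathbb{R}^p$ given by $\Omega(\mathbf{w})=\sum_{g\in\mathcal{G}}\eta_g\|\mathbf{w}_g\|_\infty$. Let $\boldsymbol\kappa\in\mathbb{R}^p$. Then Algorithm 2 (defined in the context), run on the input $(\boldsymbol\kappa,\mathcal{G},(\eta_g)_{g\in\mathcal{G}})$, computes in a finite and polynomial (in $p$ and $|\mathcal{G}|$) number of operations the value of the dual norm $$\Omega^*(\boldsymbol\kappa)=\min_{\boldsymbol\xi\in\mathbb{R}^{p\times|\mathcal{G}|},\ \tau\in\mathbb{R}}\ \tau\quad\text{s.t.}\quad\sum_{g\in\mathcal{G}}\boldsymbol\xi^g=\boldsymbol\kappa,\ \text{ and }\ \forall g\in\mathcal{G},\ \|\boldsymbol\xi^g\|_1\le\tau\eta_g\ \text{ with }\ \boldsymbol\xi^g_j=0\ \text{if}\ j\notin g .$$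
   Context: For $\mathbf{w}\in\mathbb{R}^p$, $\mathbf{w}_g\in\mathbb{R}^{|g|}$ is the vector of the coefficients of $\mathbf{w}$ indexed by $g$. The groups are nonempty, may overlap arbitrarily, and their union is $\{1,\ldots,p\}$ (so that $\Omega$ is a norm). The dual norm is $\Omega^*(\boldsymbol\kappa)=\max_{\Omega(\mathbf{z})\le 1}\mathbf{z}^\top\boldsymbol\kappa$; it is equal to the value of the minimization problem in the claim, where $\boldsymbol\xi=(\boldsymbol\xi^g)_{g\in\mathcal{G}}$ has one column $\boldsymbol\xi^g\in\mathbb{R}^p$ per group. Operations are elementary arithmetic operations and comparisons on real numbers, and max-flow steps are carried out by a (strongly) polynomial-time max-flow algorithm. Sign convention: one may assume $\boldsymbol\kappa_j\ge0$ for all $j$; for a general $\boldsymbol\kappa$ the algorithm is run on $(|\boldsymbol\kappa_j|)_j$. Flows: on a directed graph with source $s$, sink $t$ and non-negative arc capacities, a flow is a non-negative function on arcs, bounded by the capacity on each arc, such that incoming and outgoing flow are equal at every vertex other than $s,t$. Algorithm 2: build the graph $G_0=(V_0,E_0,s,t)$ with $V_0=V_u\cup V_{gr}$, $V_u=\{1,\ldots,p\}$, $V_{gr}=\mathcal{G}$, and arcs $(s,g)$ for every $g\in\mathcal{G}$ (capacity $\tau\eta_g$, with $\tau$ set below), $(g,j)$ for every $g\in\mathcal{G}$, $j\in g$ (infinite capacity), and $(j,t)$ for every $j\in\{1,\ldots,p\}$ (capacity $\boldsymbol\kappa_j$); then return $\tau\leftarrow\texttt{dualNorm}(V_0,E_0)$.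 The recursive function $\texttt{dualNorm}(V=V_u\cup V_{gr},E)$ is: (1) Set $\tau\leftarrow\big(\sum_{j\in V_u}\boldsymbol\kappa_j\big)/\big(\sum_{g\in V_{gr}}\eta_g\big)$ and set the capacities of the arcs $(s,g)$ to $\tau\eta_g$ for all $g\in V_{gr}$. (2) Max-flow step: compute a maximum flow from $s$ to $t$ on $(V,E,s,t)$, and let $\overline{\boldsymbol\xi}_j$ be its value on $(j,t)$, $j\in V_u$. (3) If there exists $j\in V_u$ with $\overline{\boldsymbol\xi}_j\ne\boldsymbol\kappa_j$: let $(s,V^+)$ and $(V^-,t)$ be the two disjoint parts of $V\cup\{s,t\}$ separated by the minimum $(s,t)$-cut, where $V^+$ is the set of vertices of $V$ reachable from $s$ by a non-saturated path (a path in the residual graph of the max-flow) and $V^-=V\setminus V^+$; remove all arcs between $V^+$ and $V^-$, let $E^-$ be the remaining arcs corresponding to $V^-$ (including the arcs to/from $s,t$), and set $\tau\leftarrow\texttt{dualNorm}(V^-,E^-)$. (4) Return $\tau$. *)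

theory Defs
  imports
    "HOL-Library.FuncSet"
    "HOL-Library.Monad_Syntax"
    "HOL-Library.Extended_Real"
    "HOL-Computational_Algebra.Polynomial"
begin

text \<open>
  A vector of \<open>\<real>\<^sup>p\<close> is a function \<open>nat \<Rightarrow> real\<close> of which only the entries with index in \<open>{1..p}\<close>
  are ever used.
\<close>

definition group_norm :: "nat set set \<Rightarrow> (nat set \<Rightarrow> real) \<Rightarrow> (nat \<Rightarrow> real) \<Rightarrow> real" where
  "group_norm G \<eta> w = (\<Sum>g\<in>G. \<eta> g * Max ((\<lambda>j. \<bar>w j\<bar>) ` g))"

definition dual_norm ::
    "nat \<Rightarrow> nat set set \<Rightarrow> (nat set \<Rightarrow> real) \<Rightarrow> (nat \<Rightarrow> real) \<Rightarrow> real" where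
  "dual_norm p G \<eta> \<kappa> = (SUP z \<in> {z. group_norm G \<eta> z \<le> 1}. \<Sum>j=1..p. z j * \<kappa> j)"

text \<open>\<open>\<xi> g\<close> is the column of the \<open>p \<times> |G|\<close> matrix \<open>\<xi>\<close> that belongs to the group \<open>g\<close>.\<close>

definition feasible ::
    "nat \<Rightarrow> nat set set \<Rightarrow> (nat set \<Rightarrow> real) \<Rightarrow> (nat \<Rightarrow> real) \<Rightarrow>
     (nat set \<Rightarrow> nat \<Rightarrow> real) \<Rightarrow> real \<Rightarrow> bool" where
  "feasible p G \<eta> \<kappa> \<xi> \<tau> \<longleftrightarrow>
     (\<forall>j\<in>{1..p}. (\<Sum>g\<in>G. \<xi> g j) = \<kappa> j) \<and>
     (\<forall>g\<in>G. (\<Sum>j=1..p. \<bar>\<xi> g j\<bar>) \<le> \<tau> * \<eta> g \<and> (\<forall>j\<in>{1..p}. j \<notin> g \<longrightarrow> \<xi> g j = 0))"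


definition network ::
    "'v set \<Rightarrow> ('v \<times> 'v) set \<Rightarrow> 'v \<Rightarrow> 'v \<Rightarrow> ('v \<times> 'v \<Rightarrow> ereal) \<Rightarrow> bool" where
  "network V E s t c \<longleftrightarrow>
     finite V \<and> E \<subseteq> V \<times> V \<and> s \<in> V \<and> t \<in> V \<and> s \<noteq> t \<and> (\<forall>a\<in>E. 0 \<le> c a)"

definition is_flow ::
    "'v set \<Rightarrow> ('v \<times> 'v) set \<Rightarrow> 'v \<Rightarrow> 'v \<Rightarrow> ('v \<times> 'v \<Rightarrow> ereal) \<Rightarrow> ('v \<times> 'v \<Rightarrow> real) \<Rightarrow> bool" where
  "is_flow V E s t c f \<longleftrightarrow>
     (\<forall>a\<in>E. 0 \<le> f a \<and> ereal (f a) \<le> c a) \<and>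
     (\<forall>v \<in> V - {s, t}. (\<Sum>a | a \<in> E \<and> snd a = v. f a) = (\<Sum>a | a \<in> E \<and> fst a = v. f a))"

definition flow_value :: "('v \<times> 'v) set \<Rightarrow> 'v \<Rightarrow> ('v \<times> 'v \<Rightarrow> real) \<Rightarrow> real" where
  "flow_value E s f = (\<Sum>a | a \<in> E \<and> fst a = s. f a) - (\<Sum>a | a \<in> E \<and> snd a = s. f a)"

definition is_max_flow ::
    "'v set \<Rightarrow> ('v \<times> 'v) set \<Rightarrow> 'v \<Rightarrow> 'v \<Rightarrow> ('v \<times> 'v \<Rightarrow> ereal) \<Rightarrow> ('v \<times> 'v \<Rightarrow> real) \<Rightarrow> bool" where
  "is_max_flow V E s t c f \<longleftrightarrow>
     is_flow V E s t c f \<and> (\<forall>f'. is_flow V E s t c f' \<longrightarrow> flow_value E s f' \<le> flow_value E s f)"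


text \<open>The second component is the number of operations spent on computing the first.\<close>

type_synonym 'a counted = "'a \<times> nat"

definition ret :: "'a \<Rightarrow> 'a counted" where
  "ret x = (x, 0)"

definition counted_bind :: "'a counted \<Rightarrow> ('a \<Rightarrow> 'b counted) \<Rightarrow> 'b counted" where
  "counted_bind m k = (fst (k (fst m)), snd m + snd (k (fst m)))"

adhoc_overloading Monad_Syntax.bind \<rightleftharpoons> counted_bind

definition ops :: "nat \<Rightarrow> unit counted" where
  "ops n = ((), n)"

text \<open>One elementary arithmetic operation or comparison, with its result \<open>x\<close>.\<close>

definition elem_op :: "'a \<Rightarrow> 'a counted" where
  "elem_op x = (x, 1)"

definition sum_family :: "'i set \<Rightarrow> ('i \<Rightarrow> real) \<Rightarrow> real counted" where
  "sum_family I x = (\<Sum>i\<in>I. x i, card I)"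

definition for_each :: "'i set \<Rightarrow> ('i \<Rightarrow> 'a counted) \<Rightarrow> ('i \<Rightarrow> 'a) counted" where
  "for_each I h = (\<lambda>i\<in>I. fst (h i), \<Sum>i\<in>I. snd (h i))"

text \<open>
  A maximum-flow subroutine, applied to vertices, arcs, source, sink and capacities, yields a flow
  and the number of operations spent. It need only be correct on finite networks whose arcs out of
  the source have finite capacity; these always have a maximum flow, even if other
  capacities are infinite. The bound depends on the size of the graph alone, not on the capacities.
\<close>

type_synonym 'v max_flow_routine =
  "'v set \<Rightarrow> ('v \<times> 'v) set \<Rightarrow> 'v \<Rightarrow> 'v \<Rightarrow> ('v \<times> 'v \<Rightarrow> ereal) \<Rightarrow> ('v \<times> 'v \<Rightarrow> real) counted"

definition strongly_polynomial_max_flow :: "'v max_flow_routine \<Rightarrow> bool" where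
  "strongly_polynomial_max_flow mf \<longleftrightarrow>
     (\<exists>Q :: nat poly. \<forall>V E s t c.
        network V E s t c \<and> (\<forall>a\<in>E. fst a = s \<longrightarrow> c a < \<infinity>) \<longrightarrow>
        is_max_flow V E s t c (fst (mf V E s t c)) \<and>
        snd (mf V E s t c) \<le> poly Q (card V + card E))"

definition residual_graph ::
    "('v \<times> 'v) set \<Rightarrow> ('v \<times> 'v \<Rightarrow> ereal) \<Rightarrow> ('v \<times> 'v \<Rightarrow> real) \<Rightarrow> ('v \<times> 'v) set counted" where
  "residual_graph E c f = do {
     unsaturated \<leftarrow> for_each E (\<lambda>a. elem_op (ereal (f a) < c a));
     nonzero \<leftarrow> for_each E (\<lambda>a. elem_op (0 < f a));
     ret ({a \<in> E. unsaturated a} \<union> {a \<in> E. nonzero a}\<inverse>)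
   }"

text \<open>
  Graph search does no arithmetic on real numbers; it is charged anyway, with one operation for
  every vertex and every arc.
\<close>

definition reachable :: "'v set \<Rightarrow> ('v \<times> 'v) set \<Rightarrow> 'v \<Rightarrow> 'v set counted" where
  "reachable V R s = do {
     ops (card V + card R);
     ret {v \<in> V. (s, v) \<in> R\<^sup>*}
   }"


datatype node = Source | Sink | Var nat | Grp "nat set"

definition nodes0 :: "nat \<Rightarrow> nat set set \<Rightarrow> node set" where
  "nodes0 p G = Var ` {1..p} \<union> Grp ` G"

definition arcs0 :: "nat \<Rightarrow> nat set set \<Rightarrow> (node \<times> node) set" where
  "arcs0 p G =
     {(Source, Grp g) | g. g \<in> G} \<union>
     {(Grp g, Var j) | g j. g \<in> G \<and> j \<in> g} \<union>
     {(Var j, Sink) | j. j \<in> {1..p}}"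

text \<open>\<open>b g\<close> is the capacity of the arc from the source to the group \<open>g\<close>.\<close>

fun capacity :: "(nat \<Rightarrow> real) \<Rightarrow> (nat set \<Rightarrow> real) \<Rightarrow> node \<times> node \<Rightarrow> ereal" where
  "capacity \<kappa> b (Source, Grp g) = ereal (b g)"
| "capacity \<kappa> b (Grp g, Var j) = \<infinity>"
| "capacity \<kappa> b (Var j, Sink) = ereal (\<kappa> j)"
| "capacity \<kappa> b _ = 0"

text \<open>
  One call of the recursive procedure, up to the recursive call: the value \<open>\<tau>\<close>, and the arguments
  of the recursive call if there is one.
\<close>

definition dual_norm_step ::
    "node max_flow_routine \<Rightarrow> (nat \<Rightarrow> real) \<Rightarrow> (nat set \<Rightarrow> real) \<Rightarrow>
     node set \<Rightarrow> (node \<times> node) set \<Rightarrow>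
     (real \<times> (node set \<times> (node \<times> node) set) option) counted" where
  "dual_norm_step mf \<kappa> \<eta> V E = do {
     let Vu = {j. Var j \<in> V};
     let Vgr = {g. Grp g \<in> V};
     a \<leftarrow> sum_family Vu \<kappa>;
     b \<leftarrow> sum_family Vgr \<eta>;
     \<tau> \<leftarrow> elem_op (a / b);
     \<tau>\<eta> \<leftarrow> for_each Vgr (\<lambda>g. elem_op (\<tau> * \<eta> g));
     let c = capacity \<kappa> \<tau>\<eta>;
     f \<leftarrow> mf (V \<union> {Source, Sink}) E Source Sink c;
     differs \<leftarrow> for_each Vu (\<lambda>j. elem_op (f (Var j, Sink) \<noteq> \<kappa> j));
     if \<exists>j\<in>Vu. differs j then do {
       R \<leftarrow> residual_graph E c f;
       Vplus \<leftarrow> reachable V R Source;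
       let Vminus = V - Vplus;
       let Eminus = E \<inter> (Vminus \<union> {Source, Sink}) \<times> (Vminus \<union> {Source, Sink});
       ops (card V + card E);
       ret (\<tau>, Some (Vminus, Eminus))
     }
     else ret (\<tau>, None)
   }"

text \<open>The result is \<open>None\<close> if the recursion does not terminate.\<close>

partial_function (option) dual_norm_rec ::
    "node max_flow_routine \<Rightarrow> (nat \<Rightarrow> real) \<Rightarrow> (nat set \<Rightarrow> real) \<Rightarrow>
     node set \<Rightarrow> (node \<times> node) set \<Rightarrow> real counted option" where
  "dual_norm_rec mf \<kappa> \<eta> V E =
     (case dual_norm_step mf \<kappa> \<eta> V E of
        ((\<tau>, None), n) \<Rightarrow> Some (\<tau>, n)
      | ((_, Some (V', E')), n) \<Rightarrow>
          Option.bind (dual_norm_rec mf \<kappa> \<eta> V' E') (\<lambda>(\<tau>, m). Some (\<tau>, n + m)))"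

text \<open>A \<open>\<kappa>\<close> of arbitrary sign is replaced by its absolute value first.\<close>

definition dual_norm_algorithm ::
    "node max_flow_routine \<Rightarrow> nat \<Rightarrow> (nat \<Rightarrow> real) \<Rightarrow> nat set set \<Rightarrow> (nat set \<Rightarrow> real) \<Rightarrow>
     real counted option" where
  "dual_norm_algorithm mf p \<kappa> G \<eta> =
     (let (\<kappa>', n) = do {
            ops (card (nodes0 p G) + card (arcs0 p G));
            for_each {1..p} (\<lambda>j. elem_op \<bar>\<kappa> j\<bar>)
          }
      in Option.bind (dual_norm_rec mf \<kappa>' \<eta> (nodes0 p G) (arcs0 p G))
           (\<lambda>(\<tau>, m). Some (\<tau>, n + m)))"

end

theory Submission
  imports Defs
begin

text \<open>
  A call on variables \<open>U\<close> and groups \<open>H\<close> uses the least value \<open>\<tau> = \<kappa>(U) / \<eta>(H)\<close> that could be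
  feasible. If the maximum flow saturates all arcs into the sink, it is a feasible \<open>\<xi>\<close>, and the
  indicator of \<open>U\<close>, scaled by \<open>1 / \<eta>(H)\<close>, is a dual point of value \<open>\<tau>\<close>. Otherwise the minimum cut
  splits the problem: no group on the source side contains a variable on the sink side, the
  variables on the source side are fully served by the groups on that side at level \<open>\<tau>\<close>, and the
  ratio \<open>\<kappa> / \<eta>\<close> strictly increases on the sink side. Hence the solution of the smaller problem on
  the sink side, glued to the flow on the source side, is feasible for \<open>(U, H)\<close> with the same value,
  and its dual point has the same norm in both problems. Every recursive call removes at
  least one vertex, so there are at most \<open>p + |G|\<close> calls.
\<close>

section \<open>Maximum flows and the residual graph\<close>

definition residual :: "('v \<times> 'v) set \<Rightarrow> ('v \<times> 'v \<Rightarrow> ereal) \<Rightarrow> ('v \<times> 'v \<Rightarrow> real) \<Rightarrow> ('v \<times> 'v) set" where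
  "residual E c f = {a \<in> E. ereal (f a) < c a} \<union> {a \<in> E. 0 < f a}\<inverse>"

text \<open>Conservation says that this vanishes, and \<open>flow_value\<close> is its negative at
  the source; being linear in \<open>h\<close>, it tracks both when a flow is perturbed.\<close>

definition net_inflow :: "('v \<times> 'v) set \<Rightarrow> ('v \<times> 'v \<Rightarrow> real) \<Rightarrow> 'v \<Rightarrow> real" where
  "net_inflow E h v = (\<Sum>a | a \<in> E \<and> snd a = v. h a) - (\<Sum>a | a \<in> E \<and> fst a = v. h a)"

lemma sum_Collect_fun_upd_add:
  fixes h :: "'a \<Rightarrow> real"
  assumes "finite E" "a \<in> E"
  shows "(\<Sum>x | x \<in> E \<and> P x. (h(a := h a + d)) x) = (\<Sum>x | x \<in> E \<and> P x. h x) + (if P a then d else 0)"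
proof -
  have "(\<Sum>x | x \<in> E \<and> P x. (h(a := h a + d)) x) = (\<Sum>x | x \<in> E \<and> P x. h x + (if x = a then d else 0))"
    by (rule sum.cong) auto
  also have "\<dots> = (\<Sum>x | x \<in> E \<and> P x. h x) + (\<Sum>x | x \<in> E \<and> P x. if x = a then d else 0)"
    by (rule sum.distrib)
  also have "(\<Sum>x | x \<in> E \<and> P x. if x = a then d else 0) = (if P a then d else 0)"
    using assms by (subst sum.delta) auto
  finally show ?thesis .
qed

lemma net_inflow_fun_upd:
  assumes "finite E" "(u, w) \<in> E"
  shows "net_inflow E (h((u, w) := h (u, w) + d)) v =
    net_inflow E h v + (if v = w then d else 0) - (if v = u then d else 0)"
  using sum_Collect_fun_upd_add[OF assms, where P = "\<lambda>a. snd a = v" and h = h and d = d]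
    sum_Collect_fun_upd_add[OF assms, where P = "\<lambda>a. fst a = v" and h = h and d = d]
  unfolding net_inflow_def by (simp del: fun_upd_apply)

lemma net_inflow_add_mult:
  "net_inflow E (\<lambda>a. f a + e * h a) v = net_inflow E f v + e * net_inflow E h v"
  unfolding net_inflow_def by (simp add: sum.distrib sum_distrib_left algebra_simps)

text \<open>The admissible directions \<open>h\<close> at \<open>f\<close> form a convex cone, so the arcs of a residual path
  may be added up one at a time, even if arcs repeat.\<close>

lemma residual_reachable_direction:
  assumes fin: "finite E"
    and reach: "(s, v) \<in> (residual E c f)\<^sup>*"
  shows "\<exists>h. (\<forall>a\<in>E. (\<not> ereal (f a) < c a \<longrightarrow> h a \<le> 0) \<and> (\<not> 0 < f a \<longrightarrow> 0 \<le> h a)) \<and>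
    (\<forall>u. net_inflow E h u = (if u = v then 1 else 0) - (if u = s then 1 else 0))"
  using reach
proof (induction rule: rtrancl_induct)
  case base
  show ?case
    by (rule exI[of _ "\<lambda>_. 0"]) (simp add: net_inflow_def)
next
  case (step v w)
  then obtain h where h: "\<forall>a\<in>E. (\<not> ereal (f a) < c a \<longrightarrow> h a \<le> 0) \<and> (\<not> 0 < f a \<longrightarrow> 0 \<le> h a)"
    and net: "\<And>u. net_inflow E h u = (if u = v then 1 else 0) - (if u = s then 1 else 0)"
    by blast
  from step.hyps(2) consider "(v, w) \<in> E" "ereal (f (v, w)) < c (v, w)"
    | "(w, v) \<in> E" "0 < f (w, v)"
    unfolding residual_def by auto
  then show ?case
  proof cases
    case 1
    let ?h = "h((v, w) := h (v, w) + 1)"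
    have "net_inflow E ?h u =
        (if u = w then 1 else 0) - (if u = s then 1 else 0)" for u
      unfolding net_inflow_fun_upd[OF fin 1(1)] net by simp
    moreover have "\<forall>a\<in>E. (\<not> ereal (f a) < c a \<longrightarrow> ?h a \<le> 0) \<and>
        (\<not> 0 < f a \<longrightarrow> 0 \<le> ?h a)"
      using h 1 by auto
    ultimately show ?thesis
      by (intro exI[of _ ?h] conjI allI)
  next
    case 2
    \<comment> \<open>A reversed arc is traversed by cancelling flow, which moves the unit of net
      inflow from \<open>v\<close> to \<open>w\<close>; written \<open>+ - 1\<close> to match
      \<open>net_inflow_fun_upd\<close>.\<close>
    let ?h = "h((w, v) := h (w, v) + - 1)"
    have "net_inflow E ?h u =
        (if u = w then 1 else 0) - (if u = s then 1 else 0)" for u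
      unfolding net_inflow_fun_upd[OF fin 2(1)] net by simp
    moreover have "\<forall>a\<in>E. (\<not> ereal (f a) < c a \<longrightarrow> ?h a \<le> 0) \<and>
        (\<not> 0 < f a \<longrightarrow> 0 \<le> ?h a)"
      using h 2 by auto
    ultimately show ?thesis
      by (intro exI[of _ ?h] conjI allI)
  qed
qed

text \<open>Arguing with \<open>eventually\<close> instead of an explicit minimum of slacks covers
  infinite capacities as well, and finitely many arcs then share one common step size.\<close>

lemma eventually_within_capacity:
  fixes x d :: real and c :: ereal
  assumes "0 \<le> x" "ereal x \<le> c"
    and "\<not> ereal x < c \<Longrightarrow> d \<le> 0" "\<not> 0 < x \<Longrightarrow> 0 \<le> d"
  shows "\<forall>\<^sub>F e in at_right 0. 0 \<le> x + e * d \<and> ereal (x + e * d) \<le> c"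
proof -
  have pos: "\<forall>\<^sub>F e :: real in at_right 0. 0 < e"
    by (rule eventually_at_right_less)
  have lim: "((\<lambda>e. x + e * d) \<longlongrightarrow> x) (at_right 0)"
    by (rule tendsto_eq_intros refl | simp)+
  have "\<forall>\<^sub>F e in at_right 0. 0 \<le> x + e * d"
  proof (cases "0 < x")
    case True
    show ?thesis
      by (rule eventually_mono[OF order_tendstoD(1)[OF lim True]]) simp
  next
    case False
    then show ?thesis
      using assms by (intro eventually_mono[OF pos]) simp
  qed
  moreover have "\<forall>\<^sub>F e in at_right 0. ereal (x + e * d) \<le> c"
  proof (cases "ereal x < c")
    case True
    have "((\<lambda>e. ereal (x + e * d)) \<longlongrightarrow> ereal x) (at_right 0)"
      using lim by simp
    from order_tendstoD(2)[OF this True] show ?thesis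
      by (rule eventually_mono) simp
  next
    case False
    then have "d \<le> 0" "c = ereal x"
      using assms by auto
    then show ?thesis
      by (intro eventually_mono[OF pos]) (simp add: mult_le_0_iff)
  qed
  ultimately show ?thesis
    by (rule eventually_conj)
qed

text \<open>The augmenting-path half of max-flow min-cut: a residual path to the sink yields a
  direction with net inflow 1 at \<open>t\<close> and -1 at \<open>s\<close>, and a small step along
  it gives a flow of larger value.\<close>

lemma max_flow_sink_unreachable:
  assumes net: "network V E s t c" and max: "is_max_flow V E s t c f"
  shows "(s, t) \<notin> (residual E c f)\<^sup>*"
proof
  assume "(s, t) \<in> (residual E c f)\<^sup>*"
  have fin: "finite E"
    using net unfolding network_def by (meson finite_SigmaI finite_subset)
  have st: "s \<noteq> t"
    using net by (simp add: network_def)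
  have flow: "is_flow V E s t c f"
    using max by (simp add: is_max_flow_def)
  obtain h where h: "\<forall>a\<in>E. (\<not> ereal (f a) < c a \<longrightarrow> h a \<le> 0) \<and> (\<not> 0 < f a \<longrightarrow> 0 \<le> h a)"
    and hnet: "\<And>u. net_inflow E h u = (if u = t then 1 else 0) - (if u = s then 1 else 0)"
    using residual_reachable_direction[OF fin \<open>(s, t) \<in> _\<close>] by blast
  have "\<forall>\<^sub>F e in at_right 0. \<forall>a\<in>E. 0 \<le> f a + e * h a \<and> ereal (f a + e * h a) \<le> c a"
    using flow h fin
    by (intro eventually_ball_finite ballI eventually_within_capacity) (auto simp: is_flow_def)
  from eventually_happens'[OF trivial_limit_at_right_real
      eventually_conj[OF this eventually_at_right_less]]
  obtain e where e: "\<forall>a\<in>E. 0 \<le> f a + e * h a \<and> ereal (f a + e * h a) \<le> c a" "0 < e"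
    by blast
  let ?f = "\<lambda>a. f a + e * h a"
  have "net_inflow E ?f v = 0" if "v \<in> V - {s, t}" for v
    using that flow by (simp add: net_inflow_add_mult hnet) (simp add: net_inflow_def is_flow_def)
  then have "is_flow V E s t c ?f"
    using e(1) unfolding is_flow_def net_inflow_def by simp
  moreover have "flow_value E s g = - net_inflow E g s" for g
    by (simp add: flow_value_def net_inflow_def)
  then have "flow_value E s ?f = flow_value E s f + e"
    using st by (simp add: net_inflow_add_mult hnet)
  ultimately show False
    using max \<open>0 < e\<close> by (fastforce simp: is_max_flow_def)
qed

section \<open>The subgraph on variables \<open>U\<close> and groups \<open>H\<close>\<close>

definition subnodes :: "nat set \<Rightarrow> nat set set \<Rightarrow> node set" where
  "subnodes U H = Var ` U \<union> Grp ` H"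

text \<open>Groups keep their original elements at every depth and only their arcs are cut down to
  \<open>g \<inter> U\<close>, so the weights \<open>\<eta>\<close> and the dual points always refer
  to the same sets.\<close>

definition subarcs :: "nat set \<Rightarrow> nat set set \<Rightarrow> (node \<times> node) set" where
  "subarcs U H =
     (\<lambda>g. (Source, Grp g)) ` H \<union>
     (\<lambda>(g, j). (Grp g, Var j)) ` (SIGMA g:H. g \<inter> U) \<union>
     (\<lambda>j. (Var j, Sink)) ` U"

lemma subarcs_iff [simp]:
  "(Source, Grp g) \<in> subarcs U H \<longleftrightarrow> g \<in> H"
  "(Grp g, Var j) \<in> subarcs U H \<longleftrightarrow> g \<in> H \<and> j \<in> g \<and> j \<in> U"
  "(Var j, Sink) \<in> subarcs U H \<longleftrightarrow> j \<in> U"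
  by (auto simp: subarcs_def)

lemma mem_subnodes [simp]:
  "Var j \<in> subnodes U H \<longleftrightarrow> j \<in> U" "Grp g \<in> subnodes U H \<longleftrightarrow> g \<in> H"
  "Source \<notin> subnodes U H" "Sink \<notin> subnodes U H"
  by (auto simp: subnodes_def)

lemma finite_subnodes [simp]: "finite U \<Longrightarrow> finite H \<Longrightarrow> finite (subnodes U H)"
  by (simp add: subnodes_def)

lemma finite_subarcs [simp]: "finite U \<Longrightarrow> finite H \<Longrightarrow> finite (subarcs U H)"
  unfolding subarcs_def by (intro finite_UnI finite_imageI finite_SigmaI) auto

lemma card_subnodes: "finite U \<Longrightarrow> finite H \<Longrightarrow> card (subnodes U H) = card U + card H"
  unfolding subnodes_def by (subst card_Un_disjoint) (auto simp: card_image inj_on_def)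

lemma card_subarcs_le:
  assumes "finite U" "finite H"
  shows "card (subarcs U H) \<le> card H + card H * card U + card U"
proof -
  have "card (SIGMA g:H. g \<inter> U) \<le> card (H \<times> U)"
    using assms by (intro card_mono) auto
  moreover have "finite (SIGMA g:H. g \<inter> U)"
    using assms by (intro finite_SigmaI) auto
  ultimately have "card ((\<lambda>(g, j). (Grp g, Var j)) ` (SIGMA g:H. g \<inter> U)) \<le> card H * card U"
    by (metis card_cartesian_product card_image_le order_trans)
  then show ?thesis
    unfolding subarcs_def
    using card_image_le[OF assms(2), of "\<lambda>g. (Source, Grp g)"]
      card_image_le[OF assms(1), of "\<lambda>j. (Var j, Sink)"]
    by (intro order_trans[OF card_Un_le] add_mono) auto
qed

lemma nodes0_eq_subnodes: "nodes0 p G = subnodes {1..p} G"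
  by (simp add: nodes0_def subnodes_def)

lemma arcs0_eq_subarcs: "G \<subseteq> Pow {1..p} \<Longrightarrow> arcs0 p G = subarcs {1..p} G"
  unfolding arcs0_def subarcs_def by (auto 0 3)

text \<open>This keeps the recursion within graphs of the form \<open>subnodes\<close>,
  \<open>subarcs\<close>, so that the induction can run over pairs of variables and groups.\<close>

lemma subarcs_Int_subnodes:
  assumes "U' \<subseteq> U" "H' \<subseteq> H"
  shows "subarcs U H \<inter> (subnodes U' H' \<union> {Source, Sink}) \<times> (subnodes U' H' \<union> {Source, Sink}) =
    subarcs U' H'"
  using assms by (auto simp: subarcs_def subnodes_def)

lemma network_subgraph:
  assumes "finite U" "finite H" "\<forall>j\<in>U. 0 \<le> \<kappa> j" "\<forall>g\<in>H. 0 \<le> b g"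
  shows "network (subnodes U H \<union> {Source, Sink}) (subarcs U H) Source Sink (capacity \<kappa> b)"
  using assms by (auto simp: network_def subarcs_def subnodes_def)

definition group_var_flow ::
    "nat set \<Rightarrow> nat set set \<Rightarrow> (node \<times> node \<Rightarrow> real) \<Rightarrow> nat set \<Rightarrow> nat \<Rightarrow> real" where
  "group_var_flow U H f g j = (if g \<in> H \<and> j \<in> g \<inter> U then f (Grp g, Var j) else 0)"

text \<open>A group node has a single incoming arc and a variable node a single outgoing arc, so
  conservation there becomes a column sum and a row sum of the matrix
  \<open>group_var_flow U H f\<close>.\<close>

lemma subgraph_flow:
  fixes f :: "node \<times> node \<Rightarrow> real"
  assumes fin: "finite U" "finite H"
    and flow: "is_flow (subnodes U H \<union> {Source, Sink}) (subarcs U H) Source Sink (capacity \<kappa> b) f"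
  shows "\<And>g j. 0 \<le> group_var_flow U H f g j"
    and "\<And>g. g \<in> H \<Longrightarrow> (\<Sum>j\<in>U. group_var_flow U H f g j) = f (Source, Grp g)"
    and "\<And>j. j \<in> U \<Longrightarrow> (\<Sum>g\<in>H. group_var_flow U H f g j) = f (Var j, Sink)"
    and "\<And>g. g \<in> H \<Longrightarrow> f (Source, Grp g) \<le> b g"
    and "\<And>j. j \<in> U \<Longrightarrow> f (Var j, Sink) \<le> \<kappa> j"
proof -
  let ?E = "subarcs U H"
  have bounds: "0 \<le> f a" "ereal (f a) \<le> capacity \<kappa> b a" if "a \<in> ?E" for a
    using flow that by (auto simp: is_flow_def)
  have conserve: "(\<Sum>a | a \<in> ?E \<and> snd a = v. f a) = (\<Sum>a | a \<in> ?E \<and> fst a = v. f a)"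
    if "v \<in> subnodes U H" for v
    using flow that by (auto simp: is_flow_def subnodes_def)
  show "0 \<le> group_var_flow U H f g j" for g j
    using bounds(1) by (auto simp: group_var_flow_def)
  show "f (Source, Grp g) \<le> b g" if "g \<in> H" for g
    using bounds(2)[of "(Source, Grp g)"] that by simp
  show "f (Var j, Sink) \<le> \<kappa> j" if "j \<in> U" for j
    using bounds(2)[of "(Var j, Sink)"] that by simp
  show "(\<Sum>j\<in>U. group_var_flow U H f g j) = f (Source, Grp g)" if g: "g \<in> H" for g
  proof -
    have "(\<Sum>j\<in>U. group_var_flow U H f g j) = (\<Sum>j\<in>g \<inter> U. f (Grp g, Var j))"
      using fin g by (intro sum.mono_neutral_cong_right) (auto simp: group_var_flow_def)
    also have "\<dots> = (\<Sum>a\<in>(\<lambda>j. (Grp g, Var j)) ` (g \<inter> U). f a)"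
      by (subst sum.reindex) (auto simp: inj_on_def)
    also have "(\<lambda>j. (Grp g, Var j)) ` (g \<inter> U) = {a. a \<in> ?E \<and> fst a = Grp g}"
      using g by (auto simp: subarcs_def)
    also have "(\<Sum>a\<in>\<dots>. f a) = (\<Sum>a | a \<in> ?E \<and> snd a = Grp g. f a)"
      using conserve[of "Grp g"] g by simp
    also have "{a. a \<in> ?E \<and> snd a = Grp g} = {(Source, Grp g)}"
      using g by (auto simp: subarcs_def)
    finally show ?thesis
      by simp
  qed
  show "(\<Sum>g\<in>H. group_var_flow U H f g j) = f (Var j, Sink)" if j: "j \<in> U" for j
  proof -
    have "(\<Sum>g\<in>H. group_var_flow U H f g j) = (\<Sum>g\<in>{g \<in> H. j \<in> g}. f (Grp g, Var j))"
      using fin j by (intro sum.mono_neutral_cong_right) (auto simp: group_var_flow_def)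
    also have "\<dots> = (\<Sum>a\<in>(\<lambda>g. (Grp g, Var j)) ` {g \<in> H. j \<in> g}. f a)"
      by (subst sum.reindex) (auto simp: inj_on_def)
    also have "(\<lambda>g. (Grp g, Var j)) ` {g \<in> H. j \<in> g} = {a. a \<in> ?E \<and> snd a = Var j}"
      using j by (auto simp: subarcs_def)
    also have "(\<Sum>a\<in>\<dots>. f a) = (\<Sum>a | a \<in> ?E \<and> fst a = Var j. f a)"
      using conserve[of "Var j"] j by simp
    also have "{a. a \<in> ?E \<and> fst a = Var j} = {(Var j, Sink)}"
      using j by (auto simp: subarcs_def)
    finally show ?thesis
      by simp
  qed
qed

section \<open>The minimum cut of a subgraph\<close>

definition unreached_vars :: "(node \<times> node) set \<Rightarrow> nat set \<Rightarrow> nat set" where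
  "unreached_vars R U = {j \<in> U. (Source, Var j) \<notin> R\<^sup>*}"

definition unreached_groups :: "(node \<times> node) set \<Rightarrow> nat set set \<Rightarrow> nat set set" where
  "unreached_groups R H = {g \<in> H. (Source, Grp g) \<notin> R\<^sup>*}"

lemma subnodes_minus_reached:
  "subnodes U H - {v \<in> subnodes U H. (Source, v) \<in> R\<^sup>*} =
    subnodes (unreached_vars R U) (unreached_groups R H)"
  by (auto simp: subnodes_def unreached_vars_def unreached_groups_def)

text \<open>The reached vertices are closed under residual arcs and do not include the sink; each
  claim applies this to one kind of arc.\<close>

lemma min_cut_subgraph:
  fixes f :: "node \<times> node \<Rightarrow> real" and b :: "nat set \<Rightarrow> real"
  assumes fin: "finite U" "finite H"
    and nonneg: "\<forall>j\<in>U. 0 \<le> \<kappa> j" "\<forall>g\<in>H. 0 \<le> b g"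
    and max: "is_max_flow (subnodes U H \<union> {Source, Sink}) (subarcs U H) Source Sink (capacity \<kappa> b) f"
  defines "R \<equiv> residual (subarcs U H) (capacity \<kappa> b) f"
  defines "U' \<equiv> unreached_vars R U" and "H' \<equiv> unreached_groups R H"
  shows "\<And>j. j \<in> U - U' \<Longrightarrow> f (Var j, Sink) = \<kappa> j"
    and "\<And>g. g \<in> H' \<Longrightarrow> f (Source, Grp g) = b g"
    and "\<And>g j. g \<in> H - H' \<Longrightarrow> j \<in> g \<Longrightarrow> j \<notin> U'"
    and "\<And>g j. g \<in> H' \<Longrightarrow> j \<in> g \<inter> (U - U') \<Longrightarrow> f (Grp g, Var j) = 0"
proof -
  let ?E = "subarcs U H"
  have flow: "is_flow (subnodes U H \<union> {Source, Sink}) ?E Source Sink (capacity \<kappa> b) f"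
    using max by (simp add: is_max_flow_def)
  have bounds: "0 \<le> f a" "ereal (f a) \<le> capacity \<kappa> b a" if "a \<in> ?E" for a
    using flow that by (auto simp: is_flow_def)
  have sink: "(Source, Sink) \<notin> R\<^sup>*"
    unfolding R_def by (rule max_flow_sink_unreachable[OF network_subgraph[OF fin nonneg] max])
  have fwd: "(Source, w) \<in> R\<^sup>*"
    if "(Source, v) \<in> R\<^sup>*" "(v, w) \<in> ?E" "ereal (f (v, w)) < capacity \<kappa> b (v, w)" for v w
    using that by (auto simp: R_def residual_def intro: rtrancl_into_rtrancl)
  have bwd: "(Source, v) \<in> R\<^sup>*"
    if "(Source, w) \<in> R\<^sup>*" "(v, w) \<in> ?E" "0 < f (v, w)" for v w
    using that by (auto simp: R_def residual_def intro: rtrancl_into_rtrancl)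
  show "f (Var j, Sink) = \<kappa> j" if "j \<in> U - U'" for j
    using that fwd[of "Var j" Sink] bounds(2)[of "(Var j, Sink)"] sink
    by (fastforce simp: U'_def unreached_vars_def)
  show "f (Source, Grp g) = b g" if "g \<in> H'" for g
    using that fwd[of Source "Grp g"] bounds(2)[of "(Source, Grp g)"]
    by (fastforce simp: H'_def unreached_groups_def)
  \<comment> \<open>Arcs from groups to variables have infinite capacity, so they are never
    saturated and a reached group reaches all its variables in \<open>U\<close>.\<close>
  show "j \<notin> U'" if "g \<in> H - H'" "j \<in> g" for g j
    using that fwd[of "Grp g" "Var j"]
    by (auto simp: H'_def U'_def unreached_groups_def unreached_vars_def)
  \<comment> \<open>Positive flow into a reached variable could be cancelled, which would reach the
    group backwards.\<close>
  show "f (Grp g, Var j) = 0" if "g \<in> H'" "j \<in> g \<inter> (U - U')" for g j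
    using that bwd[of "Var j" "Grp g"] bounds(1)[of "(Grp g, Var j)"]
    by (fastforce simp: H'_def U'_def unreached_groups_def unreached_vars_def)
qed

section \<open>One step of the recursion\<close>

lemma poly_nat_mono:
  fixes Q :: "nat poly"
  shows "m \<le> n \<Longrightarrow> poly Q m \<le> poly Q n"
  by (induction Q) (auto intro!: mult_mono)

lemma fst_bind [simp]: "fst (m \<bind> k) = fst (k (fst m))" for m :: "'a counted" and k :: "'a \<Rightarrow> 'b counted"
  by (simp add: counted_bind_def)

lemma snd_bind [simp]: "snd (m \<bind> k) = snd m + snd (k (fst m))" for m :: "'a counted" and k :: "'a \<Rightarrow> 'b counted"
  by (simp add: counted_bind_def)

lemma counted_simps [simp]:
  "fst (ret x) = x" "snd (ret x) = 0"
  "fst (elem_op x) = x" "snd (elem_op x) = 1"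
  "snd (ops n) = n"
  "fst (sum_family I u) = (\<Sum>i\<in>I. u i)" "snd (sum_family I u) = card I"
  "fst (for_each I k) = (\<lambda>i\<in>I. fst (k i))" "snd (for_each I k) = (\<Sum>i\<in>I. snd (k i))"
  by (simp_all add: ret_def elem_op_def ops_def sum_family_def for_each_def)

lemma fst_residual_graph: "fst (residual_graph E c f) = residual E c f"
  by (auto simp: residual_graph_def residual_def)

lemma snd_residual_graph: "snd (residual_graph E c f) = 2 * card E"
  by (simp add: residual_graph_def)

lemma card_residual_le: "finite E \<Longrightarrow> card (residual E c f) \<le> 2 * card E"
  unfolding residual_def
  by (rule order_trans[OF card_Un_le])
    (use card_mono[of E "{a \<in> E. ereal (f a) < c a}"] card_mono[of E "{a \<in> E. 0 < f a}"] in auto)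

text \<open>The four names are the successive results within one call; \<open>b\<close> is a
  restricted function because \<open>for_each\<close> returns one.\<close>

context
  fixes mf :: "node max_flow_routine" and \<kappa> :: "nat \<Rightarrow> real" and \<eta> :: "nat set \<Rightarrow> real"
    and U :: "nat set" and H :: "nat set set"
  fixes \<tau> b f R
  defines "\<tau> \<equiv> (\<Sum>j\<in>U. \<kappa> j) / (\<Sum>g\<in>H. \<eta> g)"
  defines "b \<equiv> (\<lambda>g\<in>H. \<tau> * \<eta> g)"
  defines "f \<equiv> fst (mf (subnodes U H \<union> {Source, Sink}) (subarcs U H) Source Sink (capacity \<kappa> b))"
  defines "R \<equiv> residual (subarcs U H) (capacity \<kappa> b) f"
begin

lemma fst_dual_norm_step:
  "fst (dual_norm_step mf \<kappa> \<eta> (subnodes U H) (subarcs U H)) =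
    (\<tau>, if \<exists>j\<in>U. f (Var j, Sink) \<noteq> \<kappa> j
        then Some (subnodes (unreached_vars R U) (unreached_groups R H),
          subarcs (unreached_vars R U) (unreached_groups R H)) else None)"
proof -
  have *: "subarcs U H \<inter> (subnodes (unreached_vars R U) (unreached_groups R H) \<union> {Source, Sink}) \<times>
      (subnodes (unreached_vars R U) (unreached_groups R H) \<union> {Source, Sink}) =
    subarcs (unreached_vars R U) (unreached_groups R H)"
    by (rule subarcs_Int_subnodes) (auto simp: unreached_vars_def unreached_groups_def)
  have "fst (dual_norm_step mf \<kappa> \<eta> (subnodes U H) (subarcs U H)) =
    (\<tau>, if \<exists>j\<in>U. f (Var j, Sink) \<noteq> \<kappa> j
        then (let V' = subnodes U H - {v \<in> subnodes U H. (Source, v) \<in> R\<^sup>*}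
          in Some (V', subarcs U H \<inter> (V' \<union> {Source, Sink}) \<times> (V' \<union> {Source, Sink}))) else None)"
    \<comment> \<open>The outcome of the comparisons is a function restricted to \<open>U\<close>;
      \<open>bex_cong\<close> supplies the \<open>j \<in> U\<close> under which it
      simplifies.\<close>
    unfolding R_def f_def b_def \<tau>_def dual_norm_step_def Let_def reachable_def
    by (simp add: fst_residual_graph cong: bex_cong)
  then show ?thesis
    unfolding subnodes_minus_reached Let_def * .
qed

text \<open>The 4 per vertex: two arithmetic passes over variables and groups, one search, one
  restriction. The 5 per arc: two residual tests, two for searching up to twice as many residual
  arcs, one restriction. The 1 is the division; the 2 inside \<open>poly Q\<close> stands for
  \<open>Source\<close> and \<open>Sink\<close>.\<close>

lemma snd_dual_norm_step_le:
  assumes fin: "finite U" "finite H"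
    and mf: "snd (mf (subnodes U H \<union> {Source, Sink}) (subarcs U H) Source Sink (capacity \<kappa> b))
      \<le> poly Q (card (subnodes U H \<union> {Source, Sink}) + card (subarcs U H))"
  shows "snd (dual_norm_step mf \<kappa> \<eta> (subnodes U H) (subarcs U H)) \<le>
    poly Q (card (subnodes U H) + 2 + card (subarcs U H)) +
      4 * card (subnodes U H) + 5 * card (subarcs U H) + 1"
proof -
  have "card (subnodes U H \<union> {Source, Sink}) \<le> card (subnodes U H) + card {Source, Sink}"
    by (rule card_Un_le)
  then have "card (subnodes U H \<union> {Source, Sink}) + card (subarcs U H)
      \<le> card (subnodes U H) + 2 + card (subarcs U H)"
    by simp
  from order_trans[OF mf poly_nat_mono[OF this]]
  have m: "snd (mf (subnodes U H \<union> {Source, Sink}) (subarcs U H) Source Sink (capacity \<kappa> b))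
      \<le> poly Q (card (subnodes U H) + 2 + card (subarcs U H))" .
  have "card (residual (subarcs U H) (capacity \<kappa> b) f) \<le> 2 * card (subarcs U H)"
    using fin by (intro card_residual_le) simp
  moreover have "snd (dual_norm_step mf \<kappa> \<eta> (subnodes U H) (subarcs U H)) \<le>
      2 * card U + 2 * card H + 1 +
      snd (mf (subnodes U H \<union> {Source, Sink}) (subarcs U H) Source Sink (capacity \<kappa> b)) +
      2 * card (subarcs U H) + (card (subnodes U H) + card (residual (subarcs U H) (capacity \<kappa> b) f)) +
      (card (subnodes U H) + card (subarcs U H))"
    unfolding f_def b_def \<tau>_def dual_norm_step_def Let_def reachable_def
    by (simp add: fst_residual_graph snd_residual_graph)
  ultimately show ?thesis
    using m card_subnodes[OF fin] by linarith
qed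

end

section \<open>Correctness of the recursion\<close>

text \<open>The counterpart of \<open>feasible\<close> after signs have been removed. Entries vanish
  at every index outside \<open>g \<inter> U\<close>, so a solution of a smaller problem is already
  extended by zero to a larger one.\<close>

definition decomposition ::
    "nat set \<Rightarrow> nat set set \<Rightarrow> (nat set \<Rightarrow> real) \<Rightarrow> (nat \<Rightarrow> real) \<Rightarrow>
     (nat set \<Rightarrow> nat \<Rightarrow> real) \<Rightarrow> real \<Rightarrow> bool" where
  "decomposition U H \<eta> \<kappa> \<xi> \<tau> \<longleftrightarrow>
     (\<forall>j\<in>U. (\<Sum>g\<in>H. \<xi> g j) = \<kappa> j) \<and>
     (\<forall>g\<in>H. (\<Sum>j\<in>U. \<xi> g j) \<le> \<tau> * \<eta> g) \<and>
     (\<forall>g\<in>H. \<forall>j. 0 \<le> \<xi> g j \<and> (j \<notin> g \<inter> U \<longrightarrow> \<xi> g j = 0))"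

text \<open>All entries are summed once by rows and once by columns. Applied to the sink side, this
  bounds the value of the recursive call from below.\<close>

lemma decomposition_total_le:
  assumes "decomposition U H \<eta> \<kappa> \<xi> \<tau>"
  shows "(\<Sum>j\<in>U. \<kappa> j) \<le> \<tau> * (\<Sum>g\<in>H. \<eta> g)"
proof -
  have "(\<Sum>j\<in>U. \<kappa> j) = (\<Sum>j\<in>U. \<Sum>g\<in>H. \<xi> g j)"
    using assms by (intro sum.cong) (auto simp: decomposition_def)
  also have "\<dots> = (\<Sum>g\<in>H. \<Sum>j\<in>U. \<xi> g j)"
    by (rule sum.swap)
  also have "\<dots> \<le> (\<Sum>g\<in>H. \<tau> * \<eta> g)"
    using assms by (intro sum_mono) (auto simp: decomposition_def)
  finally show ?thesis
    by (simp add: sum_distrib_left)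
qed

text \<open>Sink-side groups spend their whole budget \<open>\<tau> * \<eta> g\<close> on sink-side
  variables, which receive from no other group; since \<open>k\<close> is not fully served, the
  demand there exceeds the budget.\<close>

lemma cut_raises_ratio:
  fixes y :: "nat set \<Rightarrow> nat \<Rightarrow> real"
  assumes fin: "finite U" "finite H" and sub: "U' \<subseteq> U" "H' \<subseteq> H"
    and col: "\<And>g. g \<in> H' \<Longrightarrow> (\<Sum>j\<in>U. y g j) = \<tau> * \<eta> g"
    and row: "\<And>j. j \<in> U \<Longrightarrow> (\<Sum>g\<in>H. y g j) \<le> \<kappa> j"
    and sat: "\<And>j. j \<in> U - U' \<Longrightarrow> (\<Sum>g\<in>H. y g j) = \<kappa> j"
    and unsat: "k \<in> U" "(\<Sum>g\<in>H. y g k) \<noteq> \<kappa> k"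
    and out: "\<And>g j. g \<in> H - H' \<Longrightarrow> j \<in> U' \<Longrightarrow> y g j = 0"
    and into: "\<And>g j. g \<in> H' \<Longrightarrow> j \<in> U - U' \<Longrightarrow> y g j = 0"
  shows "k \<in> U'" and "\<tau> * (\<Sum>g\<in>H'. \<eta> g) < (\<Sum>j\<in>U'. \<kappa> j)"
proof -
  show k: "k \<in> U'"
    using sat unsat by auto
  have fin': "finite U'" "finite H'"
    using fin sub finite_subset by auto
  have "\<tau> * (\<Sum>g\<in>H'. \<eta> g) = (\<Sum>g\<in>H'. \<Sum>j\<in>U. y g j)"
    using col by (simp add: sum_distrib_left)
  also have "\<dots> = (\<Sum>g\<in>H'. \<Sum>j\<in>U'. y g j)"
    using fin sub into by (intro sum.cong refl sum.mono_neutral_right) auto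
  also have "\<dots> = (\<Sum>j\<in>U'. \<Sum>g\<in>H'. y g j)"
    by (rule sum.swap)
  also have "\<dots> = (\<Sum>j\<in>U'. \<Sum>g\<in>H. y g j)"
    using fin sub out by (intro sum.cong refl sum.mono_neutral_left) auto
  also have "\<dots> < (\<Sum>j\<in>U'. \<kappa> j)"
  proof (rule sum_strict_mono_ex1[OF fin'(1)])
    show "\<forall>j\<in>U'. (\<Sum>g\<in>H. y g j) \<le> \<kappa> j"
      using row sub by auto
    show "\<exists>j\<in>U'. (\<Sum>g\<in>H. y g j) < \<kappa> j"
      using row[of k] unsat k by (intro bexI[of _ k]) auto
  qed
  finally show "\<tau> * (\<Sum>g\<in>H'. \<eta> g) < (\<Sum>j\<in>U'. \<kappa> j)" .
qed

text \<open>Rows in \<open>U'\<close> get nothing from groups outside \<open>H'\<close>, so only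
  \<open>\<xi>\<close> counts there. Rows outside \<open>U'\<close> get nothing from
  \<open>H'\<close> in either matrix, so \<open>y\<close> already has the right sum. Each column
  comes whole from one matrix, and both respect the level \<open>\<tau>'\<close>.\<close>

lemma decomposition_glue:
  fixes y :: "nat set \<Rightarrow> nat \<Rightarrow> real"
  assumes fin: "finite U" "finite H" and sub: "U' \<subseteq> U" "H' \<subseteq> H"
    and nonneg: "\<And>g j. 0 \<le> y g j"
    and supp: "\<And>g j. j \<notin> g \<inter> U \<Longrightarrow> y g j = 0"
    and col: "\<And>g. g \<in> H \<Longrightarrow> (\<Sum>j\<in>U. y g j) \<le> \<tau>' * \<eta> g"
    and sat: "\<And>j. j \<in> U - U' \<Longrightarrow> (\<Sum>g\<in>H. y g j) = \<kappa> j"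
    and out: "\<And>g j. g \<in> H - H' \<Longrightarrow> j \<in> U' \<Longrightarrow> y g j = 0"
    and into: "\<And>g j. g \<in> H' \<Longrightarrow> j \<in> U - U' \<Longrightarrow> y g j = 0"
    and dec: "decomposition U' H' \<eta> \<kappa> \<xi> \<tau>'"
  shows "decomposition U H \<eta> \<kappa> (\<lambda>g. if g \<in> H' then \<xi> g else y g) \<tau>'"
  unfolding decomposition_def
proof (intro conjI ballI allI impI)
  let ?x = "\<lambda>g. if g \<in> H' then \<xi> g else y g"
  fix j assume j: "j \<in> U"
  show "(\<Sum>g\<in>H. ?x g j) = \<kappa> j"
  proof (cases "j \<in> U'")
    case True
    then have "(\<Sum>g\<in>H. ?x g j) = (\<Sum>g\<in>H'. \<xi> g j)"
      using fin sub out by (intro sum.mono_neutral_cong_right) auto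
    then show ?thesis
      using True dec by (simp add: decomposition_def)
  next
    case False
    then have "(\<Sum>g\<in>H. ?x g j) = (\<Sum>g\<in>H. y g j)"
      using j into dec by (intro sum.cong) (auto simp: decomposition_def)
    then show ?thesis
      using False j sat by simp
  qed
next
  fix g assume g: "g \<in> H"
  show "(\<Sum>j\<in>U. (if g \<in> H' then \<xi> g else y g) j) \<le> \<tau>' * \<eta> g"
  proof (cases "g \<in> H'")
    case True
    then have "(\<Sum>j\<in>U. \<xi> g j) = (\<Sum>j\<in>U'. \<xi> g j)"
      using fin sub dec by (intro sum.mono_neutral_right) (auto simp: decomposition_def)
    then show ?thesis
      using True dec by (simp add: decomposition_def)
  qed (use g col in simp)
next
  fix g j assume "g \<in> H"
  show "0 \<le> (if g \<in> H' then \<xi> g else y g) j"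
    using nonneg dec by (auto simp: decomposition_def)
  assume "j \<notin> g \<inter> U"
  then show "(if g \<in> H' then \<xi> g else y g) j = 0"
    using supp[of j g] dec sub \<open>g \<in> H\<close> unfolding decomposition_def by auto blast
qed

text \<open>\<open>W\<close> is the dual certificate: its scaled indicator attains
  \<open>\<tau>\<close>. The bounds \<open>v\<close> and \<open>e\<close> stay fixed while the graph
  shrinks, so every call is charged the same amount. The covering hypothesis keeps the denominators
  of the ratios positive.\<close>

lemma dual_norm_rec_correct:
  fixes \<kappa> :: "nat \<Rightarrow> real" and \<eta> :: "nat set \<Rightarrow> real"
  assumes mf: "\<And>V E s t c. network V E s t c \<Longrightarrow> \<forall>a\<in>E. fst a = s \<longrightarrow> c a < \<infinity> \<Longrightarrow>
      is_max_flow V E s t c (fst (mf V E s t c)) \<and>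
      snd (mf V E s t c) \<le> poly Q (card V + card E)"
    and "finite U" "finite H" "U \<noteq> {}"
    and "\<forall>j\<in>U. \<exists>g\<in>H. j \<in> g"
    and "\<forall>j\<in>U. 0 \<le> \<kappa> j" "\<forall>g\<in>H. 0 < \<eta> g"
    and "card (subnodes U H) \<le> v" "card (subarcs U H) \<le> e"
  shows "\<exists>\<tau> n \<xi> W. dual_norm_rec mf \<kappa> \<eta> (subnodes U H) (subarcs U H) = Some (\<tau>, n) \<and>
    n \<le> card (subnodes U H) * (poly Q (v + 2 + e) + 4 * v + 5 * e + 1) \<and>
    decomposition U H \<eta> \<kappa> \<xi> \<tau> \<and>
    W \<subseteq> U \<and> W \<noteq> {} \<and> \<tau> * (\<Sum>g | g \<in> H \<and> g \<inter> W \<noteq> {}. \<eta> g) \<le> (\<Sum>j\<in>W. \<kappa> j)"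
  using assms(2-)
proof (induction "card (subnodes U H)" arbitrary: U H rule: less_induct)
  case less
  note fin = less.prems(1,2) and nonneg = less.prems(5) and pos = less.prems(6)
  define K where "K = poly Q (v + 2 + e) + 4 * v + 5 * e + 1"
  define \<tau> where "\<tau> = (\<Sum>j\<in>U. \<kappa> j) / (\<Sum>g\<in>H. \<eta> g)"
  define b where "b = (\<lambda>g\<in>H. \<tau> * \<eta> g)"
  define f where "f = fst (mf (subnodes U H \<union> {Source, Sink}) (subarcs U H) Source Sink (capacity \<kappa> b))"
  define R where "R = residual (subarcs U H) (capacity \<kappa> b) f"
  define U' where "U' = unreached_vars R U"
  define H' where "H' = unreached_groups R H"
  define y where "y = group_var_flow U H f"
  \<comment> \<open>\<open>U\<close> is nonempty and covered, so some group exists and the division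
    in \<open>\<tau>\<close> is by a positive number instead of yielding the default 0.\<close>
  have "H \<noteq> {}"
    using less.prems(3,4) by auto
  then have \<eta>_pos: "0 < (\<Sum>g\<in>H. \<eta> g)"
    using fin pos by (intro sum_pos) auto
  then have \<tau>_eq: "\<tau> * (\<Sum>g\<in>H. \<eta> g) = (\<Sum>j\<in>U. \<kappa> j)"
    by (simp add: \<tau>_def)
  have \<tau>_nonneg: "0 \<le> \<tau>"
    unfolding \<tau>_def using \<eta>_pos nonneg by (intro divide_nonneg_pos sum_nonneg) auto
  have b_nonneg: "\<forall>g\<in>H. 0 \<le> b g"
    using \<tau>_nonneg pos by (simp add: b_def less_imp_le)
  have "\<forall>a\<in>subarcs U H. fst a = Source \<longrightarrow> capacity \<kappa> b a < \<infinity>"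
    by (auto simp: subarcs_def)
  note mf' = mf[OF network_subgraph[OF fin nonneg b_nonneg] this]
  then have max: "is_max_flow (subnodes U H \<union> {Source, Sink}) (subarcs U H) Source Sink (capacity \<kappa> b) f"
    by (simp add: f_def)
  then have flow: "is_flow (subnodes U H \<union> {Source, Sink}) (subarcs U H) Source Sink (capacity \<kappa> b) f"
    by (simp add: is_max_flow_def)
  note y = subgraph_flow[OF fin flow, folded y_def]
  note cut = min_cut_subgraph[OF fin nonneg b_nonneg max, folded R_def, folded U'_def H'_def]
  have y_supp: "y g j = 0" if "j \<notin> g \<inter> U" for g j
    using that by (auto simp: y_def group_var_flow_def)
  have sub: "U' \<subseteq> U" "H' \<subseteq> H"
    by (auto simp: U'_def H'_def unreached_vars_def unreached_groups_def)
  have fst_step: "fst (dual_norm_step mf \<kappa> \<eta> (subnodes U H) (subarcs U H)) =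
    (\<tau>, if \<exists>j\<in>U. f (Var j, Sink) \<noteq> \<kappa> j then Some (subnodes U' H', subarcs U' H') else None)"
    using fst_dual_norm_step[of mf \<kappa> \<eta> U H]
    by (fold \<tau>_def, fold b_def, fold f_def, fold R_def, fold U'_def H'_def)
  have mf_cost: "snd (mf (subnodes U H \<union> {Source, Sink}) (subarcs U H) Source Sink (capacity \<kappa> b))
      \<le> poly Q (card (subnodes U H \<union> {Source, Sink}) + card (subarcs U H))"
    using mf' by simp
  have "snd (dual_norm_step mf \<kappa> \<eta> (subnodes U H) (subarcs U H)) \<le>
      poly Q (card (subnodes U H) + 2 + card (subarcs U H)) +
      4 * card (subnodes U H) + 5 * card (subarcs U H) + 1"
    by (rule snd_dual_norm_step_le[where mf = mf and \<kappa> = \<kappa> and \<eta> = \<eta> and Q = Q,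
        OF fin mf_cost[unfolded b_def \<tau>_def]])
  also have "\<dots> \<le> K"
    unfolding K_def using less.prems(7,8) by (intro add_mono mult_le_mono poly_nat_mono) auto
  finally have cost: "snd (dual_norm_step mf \<kappa> \<eta> (subnodes U H) (subarcs U H)) \<le> K" .
  show ?case
  proof (cases "\<exists>j\<in>U. f (Var j, Sink) \<noteq> \<kappa> j")
    case False
    define n where "n = snd (dual_norm_step mf \<kappa> \<eta> (subnodes U H) (subarcs U H))"
    have step: "dual_norm_step mf \<kappa> \<eta> (subnodes U H) (subarcs U H) = ((\<tau>, None), n)"
      using fst_step False by (simp add: prod_eq_iff n_def)
    have "dual_norm_rec mf \<kappa> \<eta> (subnodes U H) (subarcs U H) = Some (\<tau>, n)"
      by (subst dual_norm_rec.simps) (simp add: step)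
    moreover have "1 \<le> card (subnodes U H)"
      using fin less.prems(3) card_gt_0_iff[of U] by (simp add: card_subnodes)
    then have "n \<le> card (subnodes U H) * K"
      using cost mult_le_mono[of 1 "card (subnodes U H)" n K] by (simp add: step)
    moreover have "decomposition U H \<eta> \<kappa> y \<tau>"
      unfolding decomposition_def
    proof (intro conjI ballI allI impI)
      show "(\<Sum>g\<in>H. y g j) = \<kappa> j" if "j \<in> U" for j
        using that False y(3) by simp
      show "(\<Sum>j\<in>U. y g j) \<le> \<tau> * \<eta> g" if "g \<in> H" for g
        using that y(2,4)[of g] by (simp add: b_def)
    qed (use y(1) y_supp in auto)
    \<comment> \<open>The certificate is \<open>W = U\<close>: leaving out groups that miss
      \<open>U\<close> can only decrease the left-hand side of \<open>\<tau>_eq\<close>.\<close>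
    moreover have "(\<Sum>g | g \<in> H \<and> g \<inter> U \<noteq> {}. \<eta> g) \<le> (\<Sum>g\<in>H. \<eta> g)"
      using fin pos by (intro sum_mono2) (auto simp: less_imp_le)
    then have "\<tau> * (\<Sum>g | g \<in> H \<and> g \<inter> U \<noteq> {}. \<eta> g) \<le> (\<Sum>j\<in>U. \<kappa> j)"
      unfolding \<tau>_eq[symmetric] using \<tau>_nonneg by (intro mult_left_mono)
    ultimately show ?thesis
      using less.prems(3) unfolding K_def by blast
  next
    case True
    then obtain k where k: "k \<in> U" "(\<Sum>g\<in>H. y g k) \<noteq> \<kappa> k"
      using y(3) by auto
    have sat: "(\<Sum>g\<in>H. y g j) = \<kappa> j" if "j \<in> U - U'" for j
      using that cut(1) y(3) by auto
    have out: "y g j = 0" if "g \<in> H - H'" "j \<in> U'" for g j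
      using that cut(3)[of g j] by (auto simp: y_def group_var_flow_def)
    have into: "y g j = 0" if "g \<in> H'" "j \<in> U - U'" for g j
      using that cut(4)[of g j] by (auto simp: y_def group_var_flow_def)
    have col: "(\<Sum>j\<in>U. y g j) = \<tau> * \<eta> g" if "g \<in> H'" for g
      using that sub cut(2)[of g] y(2)[of g] by (auto simp: b_def)
    have row: "(\<Sum>g\<in>H. y g j) \<le> \<kappa> j" if "j \<in> U" for j
      using that y(3,5) by auto
    note ratio = cut_raises_ratio[OF fin sub col row sat k out into]
    \<comment> \<open>A group containing a sink-side variable cannot be on the source side, so the
      cover passes to the smaller problem.\<close>
    have cover: "\<forall>j\<in>U'. \<exists>g\<in>H'. j \<in> g"
      using less.prems(4) sub cut(3) by blast
    have fin': "finite U'" "finite H'"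
      using fin sub finite_subset by auto
    \<comment> \<open>If nothing were removed, the strict inequality \<open>ratio(2)\<close> would
      contradict \<open>\<tau>_eq\<close>.\<close>
    have "U' \<noteq> U \<or> H' \<noteq> H"
      using ratio(2) \<tau>_eq by auto
    then have "subnodes U' H' \<subset> subnodes U H"
      using sub by (auto simp: subnodes_def)
    then have smaller: "card (subnodes U' H') < card (subnodes U H)"
      using fin by (intro psubset_card_mono) auto
    have "subarcs U' H' \<subseteq> subarcs U H"
      using sub by (auto simp: subarcs_def)
    then have "card (subarcs U' H') \<le> card (subarcs U H)"
      using fin by (intro card_mono) auto
    then have bounds: "card (subnodes U' H') \<le> v" "card (subarcs U' H') \<le> e"
      using smaller less.prems(7,8) by auto
    have "U' \<noteq> {}"
      using ratio(1) by auto
    have nonneg': "\<forall>j\<in>U'. 0 \<le> \<kappa> j" and pos': "\<forall>g\<in>H'. 0 < \<eta> g"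
      using sub nonneg pos by auto
    obtain \<tau>' n' \<xi> W
      where rec: "dual_norm_rec mf \<kappa> \<eta> (subnodes U' H') (subarcs U' H') = Some (\<tau>', n')"
      and n': "n' \<le> card (subnodes U' H') * K"
      and dec: "decomposition U' H' \<eta> \<kappa> \<xi> \<tau>'"
      and W: "W \<subseteq> U'" "W \<noteq> {}" "\<tau>' * (\<Sum>g | g \<in> H' \<and> g \<inter> W \<noteq> {}. \<eta> g) \<le> (\<Sum>j\<in>W. \<kappa> j)"
      using less.hyps[OF smaller fin' \<open>U' \<noteq> {}\<close> cover nonneg' pos' bounds]
      unfolding K_def by blast
    have "H' \<noteq> {}"
      using cover \<open>U' \<noteq> {}\<close> by auto
    then have "0 < (\<Sum>g\<in>H'. \<eta> g)"
      using fin' pos sub by (intro sum_pos) auto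
    \<comment> \<open>The demand of \<open>U'\<close> exceeds \<open>\<tau>\<close> times the weight
      of \<open>H'\<close> by the cut, and is at most \<open>\<tau>'\<close> times it by the
      solution found. So the level rises, and source-side columns stay within budget.\<close>
    moreover have "\<tau> * (\<Sum>g\<in>H'. \<eta> g) < \<tau>' * (\<Sum>g\<in>H'. \<eta> g)"
      using ratio(2) decomposition_total_le[OF dec] by linarith
    ultimately have \<tau>_less: "\<tau> < \<tau>'"
      by simp
    have col': "(\<Sum>j\<in>U. y g j) \<le> \<tau>' * \<eta> g" if "g \<in> H" for g
    proof -
      have "(\<Sum>j\<in>U. y g j) \<le> \<tau> * \<eta> g"
        using y(2,4)[OF that] that by (simp add: b_def)
      also have "\<dots> \<le> \<tau>' * \<eta> g"
        using \<tau>_less pos that by (intro mult_right_mono) (auto simp: less_imp_le)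
      finally show ?thesis .
    qed
    have dec': "decomposition U H \<eta> \<kappa> (\<lambda>g. if g \<in> H' then \<xi> g else y g) \<tau>'"
      by (rule decomposition_glue[OF fin sub y(1) y_supp col' sat out into dec])
    define n where "n = snd (dual_norm_step mf \<kappa> \<eta> (subnodes U H) (subarcs U H))"
    have step: "dual_norm_step mf \<kappa> \<eta> (subnodes U H) (subarcs U H) =
        ((\<tau>, Some (subnodes U' H', subarcs U' H')), n)"
      using fst_step True by (simp add: prod_eq_iff n_def)
    have "dual_norm_rec mf \<kappa> \<eta> (subnodes U H) (subarcs U H) = Some (\<tau>', n + n')"
      by (subst dual_norm_rec.simps) (simp add: step rec)
    moreover have "n + n' \<le> card (subnodes U H) * K"
    proof -
      \<comment> \<open>The vertex lost by the recursive call pays for the present call.\<close>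
      have "n + n' \<le> K + card (subnodes U' H') * K"
        using cost n' by (simp add: step)
      also have "\<dots> = Suc (card (subnodes U' H')) * K"
        by simp
      also have "\<dots> \<le> card (subnodes U H) * K"
        using smaller by (intro mult_le_mono) auto
      finally show ?thesis .
    qed
    \<comment> \<open>Since \<open>W\<close> lies in \<open>U'\<close>, every group meeting it is on
      the sink side, so the same groups weigh the certificate in both problems.\<close>
    moreover have "{g. g \<in> H \<and> g \<inter> W \<noteq> {}} = {g. g \<in> H' \<and> g \<inter> W \<noteq> {}}"
      using sub cut(3) W(1) by blast
    then have "\<tau>' * (\<Sum>g | g \<in> H \<and> g \<inter> W \<noteq> {}. \<eta> g) \<le> (\<Sum>j\<in>W. \<kappa> j)"
      using W(3) by simp
    moreover have "W \<subseteq> U"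
      using W(1) sub(1) by blast
    ultimately show ?thesis
      using dec' W(2) unfolding K_def by blast
  qed
qed

section \<open>Duality\<close>

text \<open>Hoelder's inequality between maximum and sum norm, group by group:
  \<open>\<xi> g\<close> vanishes outside \<open>g\<close>, so only the largest absolute value of
  \<open>z\<close> on \<open>g\<close> enters, and summing gives
  \<open>\<tau> * group_norm G \<eta> z\<close>.\<close>

lemma weak_duality:
  assumes G: "G \<subseteq> Pow {1..p}" "{} \<notin> G" "\<Union> G = {1..p}" and p: "1 \<le> p"
    and pos: "\<forall>g\<in>G. 0 < \<eta> g"
    and feas: "feasible p G \<eta> \<kappa> \<xi> \<tau>" and z: "group_norm G \<eta> z \<le> 1"
  shows "(\<Sum>j=1..p. z j * \<kappa> j) \<le> \<tau>"
proof -
  let ?M = "\<lambda>g. Max ((\<lambda>j. \<bar>z j\<bar>) ` g)"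
  have fin: "finite g" "g \<noteq> {}" if "g \<in> G" for g
    using that G by (auto intro: finite_subset[of g "{1..p}"] simp del: One_nat_def)
  have M: "0 \<le> ?M g" if "g \<in> G" for g
    using fin[OF that] by (auto simp: Max_ge_iff)
  \<comment> \<open>As \<open>p\<close> is positive there is a group; its constraint forces
    \<open>0 \<le> \<tau>\<close>, on which the last estimate relies.\<close>
  obtain g where g: "g \<in> G"
    using G(3) p by fastforce
  have "0 \<le> (\<Sum>j=1..p. \<bar>\<xi> g j\<bar>)"
    by (intro sum_nonneg) simp
  also have "\<dots> \<le> \<tau> * \<eta> g"
    using feas g by (simp add: feasible_def)
  finally have \<tau>: "0 \<le> \<tau>"
    using pos g by (simp add: zero_le_mult_iff) (meson less_le_not_le)
  have "(\<Sum>j=1..p. z j * \<kappa> j) = (\<Sum>j=1..p. \<Sum>g\<in>G. z j * \<xi> g j)"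
    unfolding sum_distrib_left[symmetric] using feas by (intro sum.cong refl) (simp add: feasible_def)
  also have "\<dots> = (\<Sum>g\<in>G. \<Sum>j=1..p. z j * \<xi> g j)"
    by (rule sum.swap)
  also have "\<dots> \<le> (\<Sum>g\<in>G. \<tau> * (\<eta> g * ?M g))"
  proof (rule sum_mono)
    fix g assume g: "g \<in> G"
    have "(\<Sum>j=1..p. z j * \<xi> g j) \<le> (\<Sum>j=1..p. ?M g * \<bar>\<xi> g j\<bar>)"
    proof (rule sum_mono)
      fix j assume j: "j \<in> {1..p}"
      show "z j * \<xi> g j \<le> ?M g * \<bar>\<xi> g j\<bar>"
      proof (cases "j \<in> g")
        case True
        have "z j * \<xi> g j \<le> \<bar>z j\<bar> * \<bar>\<xi> g j\<bar>"
          by (metis abs_ge_self abs_mult)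
        also have "\<dots> \<le> ?M g * \<bar>\<xi> g j\<bar>"
          using True fin[OF g] by (intro mult_right_mono Max_ge) auto
        finally show ?thesis .
      next
        case False
        then show ?thesis
          using feas g j by (auto simp: feasible_def)
      qed
    qed
    also have "\<dots> = ?M g * (\<Sum>j=1..p. \<bar>\<xi> g j\<bar>)"
      by (simp add: sum_distrib_left)
    also have "\<dots> \<le> ?M g * (\<tau> * \<eta> g)"
      using feas g M[OF g] by (intro mult_left_mono) (auto simp: feasible_def)
    finally show "(\<Sum>j=1..p. z j * \<xi> g j) \<le> \<tau> * (\<eta> g * ?M g)"
      by (simp add: ac_simps)
  qed
  also have "\<dots> = \<tau> * group_norm G \<eta> z"
    by (simp add: group_norm_def sum_distrib_left)
  also have "\<dots> \<le> \<tau>"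
    using z \<tau> by (simp add: mult_left_le)
  finally show ?thesis .
qed

text \<open>By weak duality the two certificates pin each other down; the supremum is attained at
  \<open>z\<close> and bounded by the feasible pair.\<close>

lemma dual_norm_eqI:
  assumes G: "G \<subseteq> Pow {1..p}" "{} \<notin> G" "\<Union> G = {1..p}" "1 \<le> p" "\<forall>g\<in>G. 0 < \<eta> g"
    and feas: "feasible p G \<eta> \<kappa> \<xi> \<tau>"
    and z: "group_norm G \<eta> z \<le> 1" "\<tau> \<le> (\<Sum>j=1..p. z j * \<kappa> j)"
  shows "dual_norm p G \<eta> \<kappa> = \<tau>" "(\<Sum>j=1..p. z j * \<kappa> j) = \<tau>"
proof -
  note le = weak_duality[OF G feas]
  show eq: "(\<Sum>j=1..p. z j * \<kappa> j) = \<tau>"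
    using le[OF z(1)] z(2) by simp
  show "dual_norm p G \<eta> \<kappa> = \<tau>"
    unfolding dual_norm_def
  proof (rule cSup_eq_maximum)
    show "\<tau> \<in> (\<lambda>z. \<Sum>j=1..p. z j * \<kappa> j) ` {z. group_norm G \<eta> z \<le> 1}"
      using z(1) eq by (intro image_eqI[of _ _ z]) auto
  qed (use le in auto)
qed

text \<open>Row \<open>j\<close> gets back the sign of \<open>\<kappa> j\<close>; where
  \<open>\<kappa> j = 0\<close>, \<open>sgn\<close> erases the row, consistently with its sum 0.
  Absolute values never grow, so the column bounds survive.\<close>

lemma decomposition_imp_feasible:
  assumes dec: "decomposition {1..p} G \<eta> (\<lambda>j\<in>{1..p}. \<bar>\<kappa> j\<bar>) \<xi> \<tau>"
  shows "feasible p G \<eta> \<kappa> (\<lambda>g j. sgn (\<kappa> j) * \<xi> g j) \<tau>"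
  unfolding feasible_def
proof (intro conjI ballI impI)
  fix j assume "j \<in> {1..p}"
  then show "(\<Sum>g\<in>G. sgn (\<kappa> j) * \<xi> g j) = \<kappa> j"
    using dec unfolding sum_distrib_left[symmetric] by (simp add: decomposition_def sgn_mult_abs)
next
  fix g assume g: "g \<in> G"
  have "(\<Sum>j=1..p. \<bar>sgn (\<kappa> j) * \<xi> g j\<bar>) \<le> (\<Sum>j=1..p. \<xi> g j)"
    using dec g by (intro sum_mono) (auto simp: decomposition_def abs_mult sgn_if)
  also have "\<dots> \<le> \<tau> * \<eta> g"
    using dec g by (simp add: decomposition_def)
  finally show "(\<Sum>j=1..p. \<bar>sgn (\<kappa> j) * \<xi> g j\<bar>) \<le> \<tau> * \<eta> g" .
  show "sgn (\<kappa> j) * \<xi> g j = 0" if "j \<notin> g" for j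
    using dec g that by (auto simp: decomposition_def)
qed

text \<open>With \<open>D\<close> the weight of the groups meeting \<open>W\<close>, the entries of
  \<open>z\<close> are at most \<open>1 / D\<close> in absolute value on those groups and 0 on all
  others, so the norm is at most \<open>D / D\<close>. Pairing with \<open>\<kappa>\<close> turns
  signs into absolute values over \<open>W\<close>.\<close>

lemma signed_indicator_optimal:
  fixes \<kappa> :: "nat \<Rightarrow> real"
  assumes G: "G \<subseteq> Pow {1..p}" "{} \<notin> G" "\<Union> G = {1..p}" and pos: "\<forall>g\<in>G. 0 < \<eta> g"
    and W: "W \<subseteq> {1..p}" "W \<noteq> {}"
    and le: "\<tau> * (\<Sum>g | g \<in> G \<and> g \<inter> W \<noteq> {}. \<eta> g) \<le> (\<Sum>j\<in>W. \<bar>\<kappa> j\<bar>)"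
  defines "z \<equiv> \<lambda>j. if j \<in> W then sgn (\<kappa> j) / (\<Sum>g | g \<in> G \<and> g \<inter> W \<noteq> {}. \<eta> g) else 0"
  shows "group_norm G \<eta> z \<le> 1" "\<tau> \<le> (\<Sum>j=1..p. z j * \<kappa> j)"
proof -
  define T where "T = {g. g \<in> G \<and> g \<inter> W \<noteq> {}}"
  define D where "D = (\<Sum>g\<in>T. \<eta> g)"
  have z: "z j = (if j \<in> W then sgn (\<kappa> j) / D else 0)" for j
    by (simp add: z_def D_def T_def)
  have "finite G"
    using G(1) finite_subset by blast
  then have "finite T"
    by (simp add: T_def)
  have "T \<noteq> {}"
    using W G(3) by (auto simp: T_def)
  then have D: "0 < D"
    unfolding D_def using \<open>finite T\<close> pos by (intro sum_pos) (auto simp: T_def)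
  have "\<eta> g * Max ((\<lambda>j. \<bar>z j\<bar>) ` g) \<le> (if g \<in> T then \<eta> g / D else 0)" if g: "g \<in> G" for g
  proof -
    have fin: "finite g" "g \<noteq> {}"
      using g G by (auto intro: finite_subset[of g "{1..p}"] simp del: One_nat_def)
    have "\<bar>z j\<bar> \<le> (if g \<in> T then 1 / D else 0)" if "j \<in> g" for j
      using g that D by (auto simp: z T_def sgn_if abs_mult)
    then have "Max ((\<lambda>j. \<bar>z j\<bar>) ` g) \<le> (if g \<in> T then 1 / D else 0)"
      using fin by (intro Max.boundedI) auto
    then have "\<eta> g * Max ((\<lambda>j. \<bar>z j\<bar>) ` g) \<le> \<eta> g * (if g \<in> T then 1 / D else 0)"
      using pos g by (intro mult_left_mono) (auto simp: less_imp_le)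
    then show ?thesis
      by (simp split: if_splits)
  qed
  then have "group_norm G \<eta> z \<le> (\<Sum>g\<in>G. if g \<in> T then \<eta> g / D else 0)"
    unfolding group_norm_def by (intro sum_mono)
  also have "\<dots> = (\<Sum>g\<in>T. \<eta> g / D)"
    using \<open>finite G\<close> by (intro sum.mono_neutral_cong_right) (auto simp: T_def)
  also have "\<dots> = 1"
    using D by (simp add: D_def flip: sum_divide_distrib)
  finally show "group_norm G \<eta> z \<le> 1" .
  have "(\<Sum>j=1..p. z j * \<kappa> j) = (\<Sum>j\<in>W. \<bar>\<kappa> j\<bar> / D)"
    using W(1) by (intro sum.mono_neutral_cong_right) (auto simp: z sgn_if)
  also have "\<dots> = (\<Sum>j\<in>W. \<bar>\<kappa> j\<bar>) / D"
    by (simp add: sum_divide_distrib)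
  finally show "\<tau> \<le> (\<Sum>j=1..p. z j * \<kappa> j)"
    using le D by (simp add: pos_le_divide_eq D_def T_def)
qed

theorem proposition9:
  fixes mf :: "node max_flow_routine"
  assumes "strongly_polynomial_max_flow mf"
  shows "\<exists>P :: nat poly. \<forall>(p :: nat) (G :: nat set set) (\<eta> :: nat set \<Rightarrow> real) (\<kappa> :: nat \<Rightarrow> real).
    1 \<le> p \<and> G \<subseteq> Pow {1..p} \<and> {} \<notin> G \<and> \<Union> G = {1..p} \<and> (\<forall>g\<in>G. 0 < \<eta> g) \<longrightarrow>
      (\<exists>n. dual_norm_algorithm mf p \<kappa> G \<eta> = Some (dual_norm p G \<eta> \<kappa>, n) \<and>
           n \<le> poly P (p + card G)) \<and>
      (\<exists>z. group_norm G \<eta> z \<le> 1 \<and> (\<Sum>j=1..p. z j * \<kappa> j) = dual_norm p G \<eta> \<kappa>) \<and>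
      (\<exists>\<xi>. feasible p G \<eta> \<kappa> \<xi> (dual_norm p G \<eta> \<kappa>)) \<and>
      (\<forall>\<xi> \<tau>. feasible p G \<eta> \<kappa> \<xi> \<tau> \<longrightarrow> dual_norm p G \<eta> \<kappa> \<le> \<tau>)"
proof -
  from assms obtain Q :: "nat poly" where mf: "\<And>V E s t c. network V E s t c \<Longrightarrow>
      \<forall>a\<in>E. fst a = s \<longrightarrow> c a < \<infinity> \<Longrightarrow>
      is_max_flow V E s t c (fst (mf V E s t c)) \<and>
      snd (mf V E s t c) \<le> poly Q (card V + card E)"
    unfolding strongly_polynomial_max_flow_def by blast
  define X :: "nat poly" where "X = [:0, 1:]"
  \<comment> \<open>With \<open>N = p + card G\<close>, the at most
    \<open>card G + card G * p + p\<close> arcs number at most \<open>N + N * N\<close>.\<close>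
  define A where "A = X + X * X"
  \<comment> \<open>In order: vertices and arcs of the graph to be built, \<open>p\<close> absolute
    values, and at most \<open>N\<close> calls at the uniform price for \<open>v = N\<close> and
    \<open>e = poly A N\<close>.\<close>
  define P where "P = X + A + X + X * (Q \<circ>\<^sub>p (X + 2 + A) + 4 * X + 5 * A + 1)"
  have A: "poly A n = n + n * n" for n
    by (simp add: A_def X_def)
  have P: "poly P n = n + poly A n + n + n * (poly Q (n + 2 + poly A n) + 4 * n + 5 * poly A n + 1)" for n
    by (simp add: P_def X_def poly_pcompose)
  show ?thesis
  proof (intro exI[of _ P] allI impI, elim conjE)
    fix p :: nat and G :: "nat set set" and \<eta> :: "nat set \<Rightarrow> real" and \<kappa> :: "nat \<Rightarrow> real"
    assume p: "1 \<le> p" and G: "G \<subseteq> Pow {1..p}" "{} \<notin> G" "\<Union> G = {1..p}"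
      and pos: "\<forall>g\<in>G. 0 < \<eta> g"
    define N where "N = p + card G"
    \<comment> \<open>Restricted to \<open>{1..p}\<close> because this is literally the function
      that \<open>for_each\<close> hands to the recursion.\<close>
    define \<kappa>' where "\<kappa>' = (\<lambda>j\<in>{1..p}. \<bar>\<kappa> j\<bar>)"
    have finG: "finite G"
      using G(1) finite_subset by blast
    have nodes: "card (subnodes {1..p} G) = N"
      using finG by (simp add: card_subnodes N_def)
    have "card (subarcs {1..p} G) \<le> card G + card G * p + p"
      using card_subarcs_le[of "{1..p}" G] finG by simp
    also have "\<dots> \<le> poly A N"
      by (simp add: A N_def algebra_simps)
    finally have arcs: "card (subarcs {1..p} G) \<le> poly A N" .
    have "\<forall>j\<in>{1..p}. \<exists>g\<in>G. j \<in> g"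
      using G(3) by blast
    moreover have "\<forall>j\<in>{1..p}. 0 \<le> \<kappa>' j"
      by (simp add: \<kappa>'_def)
    ultimately obtain \<tau> n \<xi> W
      where rec: "dual_norm_rec mf \<kappa>' \<eta> (subnodes {1..p} G) (subarcs {1..p} G) = Some (\<tau>, n)"
      and n: "n \<le> N * (poly Q (N + 2 + poly A N) + 4 * N + 5 * poly A N + 1)"
      and dec: "decomposition {1..p} G \<eta> \<kappa>' \<xi> \<tau>"
      and W: "W \<subseteq> {1..p}" "W \<noteq> {}"
        "\<tau> * (\<Sum>g | g \<in> G \<and> g \<inter> W \<noteq> {}. \<eta> g) \<le> (\<Sum>j\<in>W. \<kappa>' j)"
      using dual_norm_rec_correct[OF mf, of "{1..p}" G \<kappa>' \<eta> N "poly A N"] finG p pos nodes arcs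
      by auto
    have "(\<Sum>j\<in>W. \<kappa>' j) = (\<Sum>j\<in>W. \<bar>\<kappa> j\<bar>)"
      using W(1) by (intro sum.cong) (auto simp: \<kappa>'_def)
    with W(3) have "\<tau> * (\<Sum>g | g \<in> G \<and> g \<inter> W \<noteq> {}. \<eta> g) \<le> (\<Sum>j\<in>W. \<bar>\<kappa> j\<bar>)"
      by simp
    note z = signed_indicator_optimal[OF G pos W(1,2) this]
    note feas = decomposition_imp_feasible[OF dec[unfolded \<kappa>'_def]]
    note eq = dual_norm_eqI[OF G p pos feas z]
    have "dual_norm_algorithm mf p \<kappa> G \<eta> =
        Some (\<tau>, card (subnodes {1..p} G) + card (subarcs {1..p} G) + p + n)"
      using rec by (simp add: dual_norm_algorithm_def nodes0_eq_subnodes arcs0_eq_subarcs[OF G(1)]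
          counted_bind_def \<kappa>'_def)
    moreover have "card (subnodes {1..p} G) + card (subarcs {1..p} G) + p + n \<le> poly P N"
      unfolding P nodes using arcs n by (intro add_mono) (auto simp: N_def)
    ultimately have "\<exists>n. dual_norm_algorithm mf p \<kappa> G \<eta> = Some (dual_norm p G \<eta> \<kappa>, n) \<and>
        n \<le> poly P (p + card G)"
      unfolding eq(1) N_def by blast
    moreover have "\<exists>z. group_norm G \<eta> z \<le> 1 \<and> (\<Sum>j=1..p. z j * \<kappa> j) = dual_norm p G \<eta> \<kappa>"
      using z(1) eq by auto
    moreover have "\<exists>\<xi>. feasible p G \<eta> \<kappa> \<xi> (dual_norm p G \<eta> \<kappa>)"
      using feas eq(1) by auto
    moreover have "dual_norm p G \<eta> \<kappa> \<le> \<tau>'" if "feasible p G \<eta> \<kappa> \<xi>' \<tau>'" for \<xi>' \<tau>'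
      using weak_duality[OF G p pos that z(1)] unfolding eq .
    ultimately show "(\<exists>n. dual_norm_algorithm mf p \<kappa> G \<eta> = Some (dual_norm p G \<eta> \<kappa>, n) \<and>
           n \<le> poly P (p + card G)) \<and>
      (\<exists>z. group_norm G \<eta> z \<le> 1 \<and> (\<Sum>j=1..p. z j * \<kappa> j) = dual_norm p G \<eta> \<kappa>) \<and>
      (\<exists>\<xi>. feasible p G \<eta> \<kappa> \<xi> (dual_norm p G \<eta> \<kappa>)) \<and>
      (\<forall>\<xi> \<tau>. feasible p G \<eta> \<kappa> \<xi> \<tau> \<longrightarrow> dual_norm p G \<eta> \<kappa> \<le> \<tau>)"
      by blast
  qed
qed

end
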